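(* Let $k\ge 2$ be an integer and let $D$ be a digraph on $n$ vertices with dichromatic number $\vec\chi(D)\le k$ or chromatic number $\chi(D)\le 2k$. Then: \begin{itemize} \item[I.] If $D$ is sink-free, then $D$ has a quasi-kernel of size at most $\left(1-\frac1k\right)n$. \item[II.] $D$ has a quasi-kernel of size at most $n-\frac{s}{k}$, where $s$ is the number of sources of $D$ that are not sinks of $D$. \item[III.] $D$ has a quasi-kernel $Q$ such that $|N^-[Q]|\ge \frac{n}{k}$. \end{itemize}
   Context: Digraphs $D=(V(D),A(D))$ are finite, without loops or parallel arcs; a pair of opposite arcs $uv,vu$ (directed 2-cycle) is allowed. If $xy\in A(D)$, then $y$ is an out-neighbor of $x$ and $x$ is an in-neighbor of $y$. A sink is a vertex with no out-neighbors; a source is a vertex with no in-neighbors; a digraph is sink-free if it has no sinks. For vertices $u,v$, $\mathrm{dist}(u,v)\in\mathbb{Z}^{\ge 0}\cup\{\infty\}$ is the length of a shortest directed path from $u$ to $v$, and for $S\subseteq V(D)$, $\mathrm{dist}(u,S)=\min_{v\in S}\mathrm{dist}(u,v)$ (equal to $\infty$ if $S=\emptyset$). Define $N^-[S]=\{u\in V(D):\mathrm{dist}(u,S)\le 1\}$. A set of vertices is independent if there is no arc between any two of its vertices, and acyclic if the subdigraph it induces contains no directed cycle (directed 2-cycles count as directed cycles). A quasi-kernel of $D$ is an independent set $Q\subseteq V(D)$ such that $\mathrm{dist}(u,Q)\le 2$ for every $u\in V(D)$. The chromatic number $\chi(D)$ is the smallest $m$ such that $V(D)$ can be partitioned into $m$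 independent sets. The dichromatic number $\vec\chi(D)$ is the smallest $m$ such that $V(D)$ can be partitioned into $m$ acyclic sets. *)

theory Defs
  imports
    "Graph_Theory.Graph_Theory"
    "HOL-Library.Extended_Nat"
    "HOL-Library.Disjoint_Sets"
begin

definition is_sink :: "('a,'b) pre_digraph \<Rightarrow> 'a \<Rightarrow> bool" where
  "is_sink G v \<longleftrightarrow> v \<in> verts G \<and> \<not> (\<exists>w. v \<rightarrow>\<^bsub>G\<^esub> w)"

definition is_source :: "('a,'b) pre_digraph \<Rightarrow> 'a \<Rightarrow> bool" where
  "is_source G v \<longleftrightarrow> v \<in> verts G \<and> \<not> (\<exists>u. u \<rightarrow>\<^bsub>G\<^esub> v)"

definition sink_free :: "('a,'b) pre_digraph \<Rightarrow> bool" where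
  "sink_free G \<longleftrightarrow> \<not> (\<exists>v. is_sink G v)"

(* Arc_Walk represents a path by its list of arcs, so length p is the number of arcs.
   In enat the infimum of the empty set is \<infinity>. *)
definition path_dist :: "('a,'b) pre_digraph \<Rightarrow> 'a \<Rightarrow> 'a \<Rightarrow> enat" where
  "path_dist G u v = (INF p \<in> {p. pre_digraph.apath G u p v}. enat (length p))"

definition set_dist :: "('a,'b) pre_digraph \<Rightarrow> 'a \<Rightarrow> 'a set \<Rightarrow> enat" where
  "set_dist G u S = (INF v \<in> S. path_dist G u v)"

definition closed_in_nbhd :: "('a,'b) pre_digraph \<Rightarrow> 'a set \<Rightarrow> 'a set" where
  "closed_in_nbhd G S = {u \<in> verts G. set_dist G u S \<le> 1}"

definition independent_set :: "('a,'b) pre_digraph \<Rightarrow> 'a set \<Rightarrow> bool" where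
  "independent_set G S \<longleftrightarrow> S \<subseteq> verts G \<and> (\<forall>u\<in>S. \<forall>v\<in>S. \<not> u \<rightarrow>\<^bsub>G\<^esub> v)"

definition acyclic_set :: "('a,'b) pre_digraph \<Rightarrow> 'a set \<Rightarrow> bool" where
  "acyclic_set G S \<longleftrightarrow> S \<subseteq> verts G \<and> \<not> (\<exists>p. pre_digraph.cycle (G \<restriction> S) p)"

definition quasi_kernel :: "('a,'b) pre_digraph \<Rightarrow> 'a set \<Rightarrow> bool" where
  "quasi_kernel G Q \<longleftrightarrow> independent_set G Q \<and> (\<forall>u\<in>verts G. set_dist G u Q \<le> 2)"

(* For finite loop-free G both minima below are attained, because the partition into
   singletons qualifies.  The classes of partition_on are nonempty, which does not affect
   the minimum. *)
definition chromatic_number :: "('a,'b) pre_digraph \<Rightarrow> nat" where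
  "chromatic_number G =
     (LEAST m. \<exists>P. partition_on (verts G) P \<and> card P = m \<and> (\<forall>S\<in>P. independent_set G S))"

definition dichromatic_number :: "('a,'b) pre_digraph \<Rightarrow> nat" where
  "dichromatic_number G =
     (LEAST m. \<exists>P. partition_on (verts G) P \<and> card P = m \<and> (\<forall>S\<in>P. acyclic_set G S))"

end

theory Submission
  imports Defs
begin

text \<open>
  Write \<open>N(S)\<close> for the set of vertices with an out-neighbor in \<open>S\<close>, and call a vertex set
  kernel-perfect if each of its subsets induces a digraph with a kernel, that is, an independent
  set that every other vertex reaches in one step.  Acyclic sets and unions of two independent
  sets are kernel-perfect, so either hypothesis covers \<open>V\<close> by \<open>k\<close> kernel-perfect sets
  \<open>S\<^sub>i\<close> (\<open>kernel_perfect_cover\<close>).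

  For every kernel-perfect \<open>S\<close> some quasi-kernel \<open>Q\<close> satisfies \<open>S \<subseteq> Q \<union> N(Q)\<close>
  (\<open>quasi_ker_covering\<close>): take any quasi-kernel \<open>Q'\<close> of the digraph without \<open>S \<union> N(S)\<close>, and add
  to it a kernel of \<open>S - N(Q')\<close>.  Applied to a largest \<open>S\<^sub>i\<close> this is part III.

  For parts I and II, let \<open>Q\<close> be such a quasi-kernel for \<open>S = S\<^sub>i\<close>, and delete from it an
  inclusion-maximal set of vertices with an out-neighbor in \<open>Q \<union> N(Q)\<close> such that \<open>N(Q)\<close> does
  not change.
  The result \<open>R\<^sub>i\<close> is still a quasi-kernel, and each \<open>v \<in> R\<^sub>i\<close> that has an out-neighbor in
  \<open>S\<^sub>i\<close> has a private in-neighbor, that is, one whose only out-neighbor in \<open>R\<^sub>i\<close> is \<open>v\<close>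
  (\<open>quasi_ker_private\<close>).  The sets \<open>S\<^sub>i\<close> cover \<open>V\<close>, so each non-sink \<open>v\<close> that lies in all the sets
  \<open>R\<^sub>i\<close> has a private in-neighbor \<open>p v\<close> with respect to at least one of them.  In
  particular \<open>v\<close> is not a source, so each source that is not a sink is missed by some \<open>R\<^sub>i\<close>;
  averaging gives part II.  Moreover \<open>p v\<close> lies in none of the sets \<open>R\<^sub>j\<close>, because it has the
  out-neighbor \<open>v\<close> in each of them, and \<open>p\<close> is injective on these \<open>v\<close>.  If there are no
  sinks, then each vertex missed by no \<open>R\<^sub>i\<close> is thus paired with one missed by all \<open>k \<ge> 2\<close> of
  them, so a vertex is missed at least once on average.  Hence
  \<open>\<Sum>\<^sub>i card (V - R\<^sub>i) \<ge> card V\<close>, which gives part I.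
\<close>

section \<open>Quasi-kernels of finite relations\<close>

text \<open>The open in-neighborhood: the vertices with an out-neighbor in \<open>S\<close>.  It is not
  restricted to the complement of \<open>S\<close>.\<close>

definition in_nbhd :: "'a rel \<Rightarrow> 'a set \<Rightarrow> 'a set" where
  "in_nbhd E S = {u. \<exists>s\<in>S. (u, s) \<in> E}"

text \<open>No pair of \<open>E\<close> joins two elements of \<open>S\<close>.\<close>

definition indep :: "'a rel \<Rightarrow> 'a set \<Rightarrow> bool" where
  "indep E S \<longleftrightarrow> (\<forall>u\<in>S. \<forall>v\<in>S. (u, v) \<notin> E)"

text \<open>A kernel of the subdigraph induced by \<open>S\<close>.\<close>

definition kernel :: "'a rel \<Rightarrow> 'a set \<Rightarrow> 'a set \<Rightarrow> bool" where
  "kernel E S K \<longleftrightarrow> K \<subseteq> S \<and> indep E K \<and> S \<subseteq> K \<union> in_nbhd E K"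

text \<open>Every induced subdigraph of the subdigraph induced by \<open>S\<close> has a kernel.\<close>

definition kernel_perfect :: "'a rel \<Rightarrow> 'a set \<Rightarrow> bool" where
  "kernel_perfect E S \<longleftrightarrow> (\<forall>T\<subseteq>S. \<exists>K. kernel E T K)"

text \<open>A quasi-kernel of the subdigraph induced by \<open>V\<close>; walks of length 2 must have their middle
  vertex in \<open>V\<close>.\<close>

definition quasi_ker :: "'a rel \<Rightarrow> 'a set \<Rightarrow> 'a set \<Rightarrow> bool" where
  "quasi_ker E V Q \<longleftrightarrow> Q \<subseteq> V \<and> indep E Q \<and>
     V \<subseteq> Q \<union> in_nbhd E Q \<union> in_nbhd E (in_nbhd E Q \<inter> V)"

text \<open>A kernel \<open>K\<close> of \<open>S - N(Q')\<close> has no arc to \<open>Q'\<close>, and no arc leads from \<open>Q'\<close> to \<open>K\<close> because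
  \<open>Q'\<close> avoids \<open>N(S)\<close>.  Every vertex of \<open>S\<close> is then in or one step away from \<open>Q' \<union> K\<close>, so
  the vertices of \<open>N(S)\<close> are at most two steps away.\<close>

lemma quasi_ker_extend:
  assumes S: "S \<subseteq> V" "kernel_perfect E S"
    and Q': "quasi_ker E (V - (S \<union> in_nbhd E S)) Q'"
  shows "\<exists>Q. quasi_ker E V Q \<and> S \<subseteq> Q \<union> in_nbhd E Q"
proof -
  obtain K where K: "kernel E (S - in_nbhd E Q') K"
    using S(2) unfolding kernel_perfect_def by (meson Diff_subset)
  have S_cov: "S \<subseteq> (Q' \<union> K) \<union> in_nbhd E (Q' \<union> K)"
    using K unfolding kernel_def in_nbhd_def by blast
  have "indep E (Q' \<union> K)"
    using K Q' unfolding kernel_def quasi_ker_def indep_def in_nbhd_def by blast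
  moreover have "Q' \<union> K \<subseteq> V"
    using K Q' S(1) unfolding kernel_def quasi_ker_def by blast
  moreover have "V \<subseteq> (Q' \<union> K) \<union> in_nbhd E (Q' \<union> K) \<union> in_nbhd E (in_nbhd E (Q' \<union> K) \<inter> V)"
  proof
    fix v assume v: "v \<in> V"
    consider "v \<in> S" | s where "s \<in> S" "(v, s) \<in> E" | "v \<in> V - (S \<union> in_nbhd E S)"
      using v unfolding in_nbhd_def by blast
    then show "v \<in> (Q' \<union> K) \<union> in_nbhd E (Q' \<union> K) \<union> in_nbhd E (in_nbhd E (Q' \<union> K) \<inter> V)"
    proof cases
      case 1
      then show ?thesis using S_cov by blast
    next
      case 2
      then show ?thesis using S_cov S(1) unfolding in_nbhd_def by blast
    next
      case 3
      then show ?thesis using Q' unfolding quasi_ker_def in_nbhd_def by blast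
    qed
  qed
  ultimately show ?thesis using S_cov unfolding quasi_ker_def by blast
qed

lemma kernel_perfect_singleton: "(v, v) \<notin> E \<Longrightarrow> kernel_perfect E {v}"
  unfolding kernel_perfect_def
proof (intro allI impI)
  fix T assume "(v, v) \<notin> E" "T \<subseteq> {v}"
  then have "kernel E T T" unfolding kernel_def indep_def by blast
  then show "\<exists>K. kernel E T K" by blast
qed

text \<open>The theorem of Chvatal and Lovasz, by induction with singletons as kernel-perfect sets.\<close>

lemma quasi_ker_exists:
  assumes "finite V" "\<And>v. (v, v) \<notin> E"
  shows "\<exists>Q. quasi_ker E V Q"
  using assms(1)
proof (induction V rule: finite_psubset_induct)
  case (psubset V)
  show ?case
  proof (cases "V = {}")
    case True
    then have "quasi_ker E V {}" by (simp add: quasi_ker_def indep_def)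
    then show ?thesis ..
  next
    case False
    then obtain v where v: "v \<in> V" by blast
    obtain Q' where "quasi_ker E (V - ({v} \<union> in_nbhd E {v})) Q'"
      using psubset.IH[of "V - ({v} \<union> in_nbhd E {v})"] v by blast
    then show ?thesis
      using quasi_ker_extend[of "{v}" V E Q'] v kernel_perfect_singleton[OF assms(2)] by blast
  qed
qed

lemma quasi_ker_covering:
  assumes "finite V" "\<And>v. (v, v) \<notin> E" "S \<subseteq> V" "kernel_perfect E S"
  shows "\<exists>Q. quasi_ker E V Q \<and> S \<subseteq> Q \<union> in_nbhd E Q"
proof -
  obtain Q' where "quasi_ker E (V - (S \<union> in_nbhd E S)) Q'"
    using quasi_ker_exists[of "V - (S \<union> in_nbhd E S)" E] assms by auto
  then show ?thesis using quasi_ker_extend assms by blast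
qed

text \<open>The reduction of a quasi-kernel to one with private in-neighbors.\<close>

lemma quasi_ker_private:
  assumes fin: "finite V" and EV: "E \<subseteq> V \<times> V"
    and Q: "quasi_ker E V Q" and S: "S \<subseteq> Q \<union> in_nbhd E Q"
  shows "\<exists>R. quasi_ker E V R \<and>
    (\<forall>v\<in>R \<inter> in_nbhd E S. \<exists>p. (p, v) \<in> E \<and> (\<forall>x\<in>R. (p, x) \<in> E \<longrightarrow> x = v))"
proof -
  \<comment> \<open>Vertices of \<open>Q\<close> without an out-neighbor in \<open>Q \<union> N(Q)\<close> must stay: once deleted, they
    would be at distance more than 2.\<close>
  define ok where "ok R \<longleftrightarrow> Q - in_nbhd E (Q \<union> in_nbhd E Q) \<subseteq> R \<and> R \<subseteq> Q \<and>
    in_nbhd E R = in_nbhd E Q" for R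
  have "Q \<subseteq> V" using Q by (simp add: quasi_ker_def)
  then have "finite Q" using fin by (rule finite_subset)
  have "{R. ok R} \<subseteq> Pow Q" by (auto simp: ok_def)
  then have "finite {R. ok R}" using \<open>finite Q\<close> finite_subset by blast
  moreover have "ok Q" by (auto simp: ok_def)
  ultimately obtain R where R: "ok R" and min: "\<And>R'. ok R' \<Longrightarrow> R' \<subseteq> R \<Longrightarrow> R' = R"
    using finite_has_minimal[of "{R. ok R}"] by auto
  have "quasi_ker E V R"
    unfolding quasi_ker_def
  proof (intro conjI)
    show "R \<subseteq> V" using R \<open>Q \<subseteq> V\<close> by (auto simp: ok_def)
    show "indep E R" using R Q unfolding ok_def indep_def quasi_ker_def by blast
    \<comment> \<open>A deleted vertex has an out-neighbor in \<open>Q \<union> N(Q)\<close>, which lies in \<open>N(Q)\<close> as \<open>Q\<close> is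
      independent; and \<open>N(Q) = N(R)\<close>.\<close>
    have "Q \<subseteq> R \<union> in_nbhd E (in_nbhd E Q \<inter> V)"
    proof
      fix q assume q: "q \<in> Q"
      show "q \<in> R \<union> in_nbhd E (in_nbhd E Q \<inter> V)"
      proof (cases "q \<in> in_nbhd E (Q \<union> in_nbhd E Q)")
        case True
        then obtain w where w: "(q, w) \<in> E" "w \<in> Q \<union> in_nbhd E Q" by (auto simp: in_nbhd_def)
        have "w \<notin> Q" using Q q w(1) by (auto simp: quasi_ker_def indep_def)
        then have "w \<in> in_nbhd E Q \<inter> V" using w EV by auto
        then show ?thesis using w(1) by (auto simp: in_nbhd_def)
      next
        case False
        then show ?thesis using R q by (auto simp: ok_def)
      qed
    qed
    then show "V \<subseteq> R \<union> in_nbhd E R \<union> in_nbhd E (in_nbhd E R \<inter> V)"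
      using R Q unfolding ok_def quasi_ker_def by auto
  qed
  moreover have "\<exists>p. (p, v) \<in> E \<and> (\<forall>x\<in>R. (p, x) \<in> E \<longrightarrow> x = v)"
    if v: "v \<in> R" "v \<in> in_nbhd E S" for v
  proof -
    \<comment> \<open>As \<open>v\<close> is not forced to stay, minimality says that deleting it changes \<open>N(R)\<close>.\<close>
    have "\<not> ok (R - {v})" using min[of "R - {v}"] v by blast
    moreover have "v \<in> in_nbhd E (Q \<union> in_nbhd E Q)"
      using v(2) S unfolding in_nbhd_def by blast
    ultimately have "in_nbhd E (R - {v}) \<noteq> in_nbhd E R"
      using R unfolding ok_def by auto
    then show ?thesis unfolding in_nbhd_def by blast
  qed
  ultimately show ?thesis by blast
qed

section \<open>Averaging over a cover by kernel-perfect sets\<close>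

lemma exists_average:
  fixes f :: "nat \<Rightarrow> nat"
  assumes "k > 0" "N \<le> (\<Sum>i<k. f i)"
  shows "\<exists>i<k. N \<le> k * f i"
proof (rule ccontr)
  assume "\<not> ?thesis"
  then have "(\<Sum>i<k. k * f i) < (\<Sum>i<k. N)"
    using assms(1) by (intro sum_strict_mono) auto
  then have "k * (\<Sum>i<k. f i) < k * N" by (simp add: sum_distrib_left)
  then show False using assms by simp
qed

lemma sum_card_eq_sum_count:
  fixes A :: "nat \<Rightarrow> 'a set"
  assumes "finite V" "\<And>i. i < k \<Longrightarrow> A i \<subseteq> V"
  shows "(\<Sum>i<k. card (A i)) = (\<Sum>v\<in>V. card {i. i < k \<and> v \<in> A i})"
proof -
  have "(\<Sum>i<k. card (A i)) = (\<Sum>i<k. \<Sum>v\<in>V. if v \<in> A i then 1 else 0)"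
  proof (rule sum.cong)
    fix i assume "i \<in> {..<k}"
    then have "A i \<subseteq> V" using assms(2) by simp
    then have "{v \<in> V. v \<in> A i} = A i" by blast
    then show "card (A i) = (\<Sum>v\<in>V. if v \<in> A i then 1 else 0)"
      using assms(1) by (simp add: sum.If_cases Int_def)
  qed simp
  also have "\<dots> = (\<Sum>v\<in>V. \<Sum>i<k. if v \<in> A i then 1 else 0)" by (rule sum.swap)
  also have "\<dots> = (\<Sum>v\<in>V. card {i. i < k \<and> v \<in> A i})"
    by (simp add: sum.If_cases Int_def)
  finally show ?thesis .
qed

lemma exists_covering_many:
  fixes A :: "nat \<Rightarrow> 'a set"
  assumes "finite V" "k > 0" "\<And>i. i < k \<Longrightarrow> A i \<subseteq> V" "T \<subseteq> V"
    and "\<And>v. v \<in> T \<Longrightarrow> \<exists>i<k. v \<in> A i"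
  shows "\<exists>i<k. card T \<le> k * card (A i)"
proof (rule exists_average[OF assms(2)])
  have "card T = (\<Sum>v\<in>T. 1)" by simp
  also have "\<dots> \<le> (\<Sum>v\<in>T. card {i. i < k \<and> v \<in> A i})"
  proof (rule sum_mono)
    fix v assume "v \<in> T"
    then have "{i. i < k \<and> v \<in> A i} \<noteq> {}" using assms(5) by blast
    then show "1 \<le> card {i. i < k \<and> v \<in> A i}" by (simp add: Suc_le_eq card_gt_0_iff)
  qed
  also have "\<dots> \<le> (\<Sum>v\<in>V. card {i. i < k \<and> v \<in> A i})"
    using assms(1,4) by (intro sum_mono2) auto
  also have "\<dots> = (\<Sum>i<k. card (A i))"
    by (rule sum_card_eq_sum_count[symmetric]) (use assms in auto)
  finally show "card T \<le> (\<Sum>i<k. card (A i))" .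
qed

text \<open>If every element in none of the \<open>A i\<close> is paired with an element in all \<open>k \<ge> 2\<close> of them, then
  on average an element lies in at least one of them.\<close>

lemma exists_large_member:
  fixes A :: "nat \<Rightarrow> 'a set"
  assumes "finite V" "k \<ge> 2" "\<And>i. i < k \<Longrightarrow> A i \<subseteq> V"
    and inj: "inj_on p (V - (\<Union>i<k. A i))"
    and p: "\<And>v. v \<in> V - (\<Union>i<k. A i) \<Longrightarrow> p v \<in> (\<Inter>i<k. A i)"
  shows "\<exists>i<k. card V \<le> k * card (A i)"
proof (rule exists_average)
  define X where "X = V - (\<Union>i<k. A i)"
  define c where "c v = card {i. i < k \<and> v \<in> A i}" for v
  have "0 < k" using assms(2) by simp
  then have pV: "p ` X \<subseteq> V" using p assms(3) unfolding X_def by blast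
  have "X \<subseteq> V" by (auto simp: X_def)
  have disj: "X \<inter> p ` X = {}" using p \<open>0 < k\<close> unfolding X_def by blast
  have fin: "finite X" "finite (p ` X)"
    using \<open>X \<subseteq> V\<close> assms(1) finite_subset by blast+
  have cardp: "card (p ` X) = card X" using inj unfolding X_def by (rule card_image)
  have "card V = card (V - (X \<union> p ` X)) + card (X \<union> p ` X)"
    using pV \<open>X \<subseteq> V\<close> assms(1) by (metis Un_least add.commute card_Diff_subset card_mono
      finite_subset le_add_diff_inverse)
  also have "\<dots> = card (V - (X \<union> p ` X)) + 2 * card (p ` X)"
    using disj fin cardp by (simp add: card_Un_disjoint)
  also have "\<dots> = (\<Sum>v\<in>V - (X \<union> p ` X). 1) + (\<Sum>v\<in>p ` X. 2)" by simp
  also have "\<dots> \<le> (\<Sum>v\<in>V - (X \<union> p ` X). c v) + (\<Sum>v\<in>p ` X. c v)"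
  proof (intro add_mono sum_mono)
    fix v assume "v \<in> V - (X \<union> p ` X)"
    then have "{i. i < k \<and> v \<in> A i} \<noteq> {}" by (auto simp: X_def)
    then show "1 \<le> c v" by (simp add: c_def Suc_le_eq card_gt_0_iff)
  next
    fix v assume "v \<in> p ` X"
    then have "{i. i < k \<and> v \<in> A i} = {..<k}" using p unfolding X_def by blast
    then show "2 \<le> c v" using assms(2) by (simp add: c_def)
  qed
  also have "\<dots> = (\<Sum>v\<in>(V - (X \<union> p ` X)) \<union> p ` X. c v)"
    using assms(1) fin by (intro sum.union_disjoint[symmetric]) auto
  also have "\<dots> \<le> (\<Sum>v\<in>V. c v)"
    using assms(1) pV by (intro sum_mono2) auto
  also have "\<dots> = (\<Sum>i<k. card (A i))"
    unfolding c_def by (rule sum_card_eq_sum_count[symmetric]) (use assms in auto)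
  finally show "card V \<le> (\<Sum>i<k. card (A i))" .
qed (use assms in simp)

text \<open>An element of \<open>Domain E\<close>, that is, a non-sink, has an out-neighbor in some \<open>S i\<close>, and \<open>R i\<close>
  for this \<open>i\<close> supplies the private in-neighbor.\<close>

lemma quasi_ker_family:
  fixes S :: "nat \<Rightarrow> 'a set"
  assumes fin: "finite V" and EV: "E \<subseteq> V \<times> V" and irr: "\<And>v. (v, v) \<notin> E"
    and S: "\<And>i. i < k \<Longrightarrow> S i \<subseteq> V \<and> kernel_perfect E (S i)"
    and cover: "V \<subseteq> (\<Union>i<k. S i)"
  obtains R where "\<And>i. i < k \<Longrightarrow> quasi_ker E V (R i)"
    and "\<And>v. v \<in> Domain E \<Longrightarrow> v \<in> (\<Inter>i<k. R i) \<Longrightarrow>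
      \<exists>i<k. \<exists>p. (p, v) \<in> E \<and> (\<forall>x\<in>R i. (p, x) \<in> E \<longrightarrow> x = v)"
proof -
  have "\<exists>R. quasi_ker E V R \<and>
    (\<forall>v\<in>R \<inter> in_nbhd E (S i). \<exists>p. (p, v) \<in> E \<and> (\<forall>x\<in>R. (p, x) \<in> E \<longrightarrow> x = v))"
    if "i < k" for i
    using quasi_ker_covering[OF fin irr, of "S i"] quasi_ker_private[OF fin EV] S[OF that]
    by blast
  then obtain R where R: "\<And>i. i < k \<Longrightarrow> quasi_ker E V (R i) \<and>
    (\<forall>v\<in>R i \<inter> in_nbhd E (S i). \<exists>p. (p, v) \<in> E \<and> (\<forall>x\<in>R i. (p, x) \<in> E \<longrightarrow> x = v))"
    by metis
  show thesis
  proof (rule that)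
    show "quasi_ker E V (R i)" if "i < k" for i using R that by blast
    fix v assume v: "v \<in> Domain E" "v \<in> (\<Inter>i<k. R i)"
    then obtain w where "(v, w) \<in> E" by blast
    moreover from this obtain i where "i < k" "w \<in> S i" using EV cover by blast
    ultimately have "v \<in> R i \<inter> in_nbhd E (S i)" using v unfolding in_nbhd_def by blast
    then show "\<exists>i<k. \<exists>p. (p, v) \<in> E \<and> (\<forall>x\<in>R i. (p, x) \<in> E \<longrightarrow> x = v)"
      using R \<open>i < k\<close> by blast
  qed
qed

lemma small_quasi_ker:
  fixes S :: "nat \<Rightarrow> 'a set"
  assumes fin: "finite V" and EV: "E \<subseteq> V \<times> V" and irr: "\<And>v. (v, v) \<notin> E" and k: "k \<ge> 2"
    and S: "\<And>i. i < k \<Longrightarrow> S i \<subseteq> V \<and> kernel_perfect E (S i)"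
    and cover: "V \<subseteq> (\<Union>i<k. S i)"
    and sink_free: "V \<subseteq> Domain E"
  shows "\<exists>Q. quasi_ker E V Q \<and> card V \<le> k * card (V - Q)"
proof -
  obtain R where R: "\<And>i. i < k \<Longrightarrow> quasi_ker E V (R i)"
    and priv: "\<And>v. v \<in> Domain E \<Longrightarrow> v \<in> (\<Inter>i<k. R i) \<Longrightarrow>
      \<exists>i<k. \<exists>p. (p, v) \<in> E \<and> (\<forall>x\<in>R i. (p, x) \<in> E \<longrightarrow> x = v)"
    using quasi_ker_family[OF fin EV irr S cover] by blast
  have X: "V - (\<Union>i<k. V - R i) = (\<Inter>i<k. R i) \<inter> V" by auto
  define p where "p v = (SOME p. \<exists>i<k. (p, v) \<in> E \<and> (\<forall>x\<in>R i. (p, x) \<in> E \<longrightarrow> x = v))" for v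
  have p: "\<exists>i<k. (p v, v) \<in> E \<and> (\<forall>x\<in>R i. (p v, x) \<in> E \<longrightarrow> x = v)"
    if "v \<in> (\<Inter>i<k. R i) \<inter> V" for v
  proof -
    have "\<exists>q. \<exists>i<k. (q, v) \<in> E \<and> (\<forall>x\<in>R i. (q, x) \<in> E \<longrightarrow> x = v)"
      using priv[of v] that sink_free by blast
    then show ?thesis unfolding p_def by (rule someI_ex)
  qed
  have "\<exists>i<k. card V \<le> k * card (V - R i)"
  proof (rule exists_large_member[OF fin k, where p = p])
    show "inj_on p (V - (\<Union>i<k. V - R i))"
      unfolding X
    proof (rule inj_onI)
      fix v v' assume v: "v \<in> (\<Inter>i<k. R i) \<inter> V" "v' \<in> (\<Inter>i<k. R i) \<inter> V" "p v = p v'"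
      \<comment> \<open>Privacy with respect to a single \<open>R i\<close> suffices, since both vertices lie in it.\<close>
      obtain i where "i < k" and i: "\<forall>x\<in>R i. (p v, x) \<in> E \<longrightarrow> x = v" using p[OF v(1)] by blast
      have "(p v, v') \<in> E" using p[OF v(2)] v(3) by auto
      moreover have "v' \<in> R i" using v(2) \<open>i < k\<close> by blast
      ultimately show "v = v'" using i by blast
    qed
    show "p v \<in> (\<Inter>i<k. V - R i)" if "v \<in> V - (\<Union>i<k. V - R i)" for v
    proof -
      have v: "v \<in> (\<Inter>i<k. R i) \<inter> V" using that unfolding X .
      then have pv: "(p v, v) \<in> E" using p by blast
      show ?thesis
      proof (rule INT_I)
        fix i assume "i \<in> {..<k}"
        then have "v \<in> R i" "indep E (R i)" using v R by (auto simp: quasi_ker_def)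
        then show "p v \<in> V - R i" using pv EV unfolding indep_def by blast
      qed
    qed
  qed auto
  then show ?thesis using R by blast
qed

text \<open>The set \<open>Domain E - Range E\<close> consists of the sources that are not sinks.\<close>

lemma quasi_ker_avoiding_sources:
  fixes S :: "nat \<Rightarrow> 'a set"
  assumes fin: "finite V" and EV: "E \<subseteq> V \<times> V" and irr: "\<And>v. (v, v) \<notin> E" and k: "k > 0"
    and S: "\<And>i. i < k \<Longrightarrow> S i \<subseteq> V \<and> kernel_perfect E (S i)"
    and cover: "V \<subseteq> (\<Union>i<k. S i)"
  shows "\<exists>Q. quasi_ker E V Q \<and> card (Domain E - Range E) \<le> k * card (V - Q)"
proof -
  obtain R where R: "\<And>i. i < k \<Longrightarrow> quasi_ker E V (R i)"
    and priv: "\<And>v. v \<in> Domain E \<Longrightarrow> v \<in> (\<Inter>i<k. R i) \<Longrightarrow>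
      \<exists>i<k. \<exists>p. (p, v) \<in> E \<and> (\<forall>x\<in>R i. (p, x) \<in> E \<longrightarrow> x = v)"
    using quasi_ker_family[OF fin EV irr S cover] by blast
  have "\<exists>i<k. card (Domain E - Range E) \<le> k * card (V - R i)"
  proof (rule exists_covering_many[OF fin k])
    show "\<exists>i<k. v \<in> V - R i" if "v \<in> Domain E - Range E" for v
      using priv[of v] that EV by blast
  qed (use EV in auto)
  then show ?thesis using R by blast
qed

lemma quasi_ker_large_in_nbhd:
  fixes S :: "nat \<Rightarrow> 'a set"
  assumes fin: "finite V" and irr: "\<And>v. (v, v) \<notin> E" and k: "k > 0"
    and S: "\<And>i. i < k \<Longrightarrow> S i \<subseteq> V \<and> kernel_perfect E (S i)"
    and cover: "V \<subseteq> (\<Union>i<k. S i)"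
  shows "\<exists>Q. quasi_ker E V Q \<and> card V \<le> k * card ((Q \<union> in_nbhd E Q) \<inter> V)"
proof -
  have "\<exists>i<k. card V \<le> k * card (S i)"
    by (rule exists_covering_many[OF fin k]) (use S cover in auto)
  then obtain i where i: "i < k" "card V \<le> k * card (S i)" by blast
  obtain Q where Q: "quasi_ker E V Q" "S i \<subseteq> Q \<union> in_nbhd E Q"
    using quasi_ker_covering[OF fin irr] S i(1) by blast
  have "card (S i) \<le> card ((Q \<union> in_nbhd E Q) \<inter> V)"
    using Q(2) S[OF i(1)] fin by (intro card_mono) auto
  then show ?thesis using Q(1) i(2) by (meson le_trans mult_le_mono2)
qed

section \<open>Kernel-perfect sets\<close>

text \<open>It suffices to find kernels of induced subdigraphs without sinks: a sink \<open>v\<close> can be added to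
  any kernel of the subdigraph without \<open>v\<close> and its in-neighbors.\<close>

lemma kernel_perfectI:
  assumes "finite S" "\<And>v. (v, v) \<notin> E"
    and sf: "\<And>T. T \<subseteq> S \<Longrightarrow> T \<subseteq> in_nbhd E T \<Longrightarrow> \<exists>K. kernel E T K"
  shows "kernel_perfect E S"
  unfolding kernel_perfect_def
proof (intro allI impI)
  fix T assume "T \<subseteq> S"
  then have "finite T" using assms(1) finite_subset by blast
  then show "\<exists>K. kernel E T K" using \<open>T \<subseteq> S\<close>
  proof (induction T rule: finite_psubset_induct)
    case (psubset T)
    show ?case
    proof (cases "T \<subseteq> in_nbhd E T")
      case True
      then show ?thesis using sf psubset.prems by blast
    next
      case False
      then obtain v where v: "v \<in> T" "v \<notin> in_nbhd E T" by blast
      obtain K where "kernel E (T - ({v} \<union> in_nbhd E {v})) K"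
        using psubset.IH[of "T - ({v} \<union> in_nbhd E {v})"] psubset.prems v(1) by blast
      then have "kernel E T (insert v K)"
        using v assms(2)[of v] unfolding kernel_def indep_def in_nbhd_def by blast
      then show ?thesis ..
    qed
  qed
qed

text \<open>In a sink-free subset of \<open>A \<union> B\<close>, each vertex of \<open>B\<close> has an out-neighbor in \<open>A\<close>, so the part in
  \<open>A\<close> is a kernel.\<close>

lemma kernel_perfect_Un_indep:
  assumes "finite A" "finite B" "\<And>v. (v, v) \<notin> E" "indep E A" "indep E B"
  shows "kernel_perfect E (A \<union> B)"
proof (rule kernel_perfectI)
  fix T assume "T \<subseteq> A \<union> B" "T \<subseteq> in_nbhd E T"
  then have "kernel E T (T \<inter> A)"
    using assms(4,5) unfolding kernel_def indep_def in_nbhd_def by blast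
  then show "\<exists>K. kernel E T K" ..
qed (use assms in auto)

text \<open>Only the empty subset is sink-free.\<close>

lemma kernel_perfect_acyclic:
  assumes "finite S" "\<And>v. (v, v) \<notin> E" "acyclic (E \<inter> S \<times> S)"
  shows "kernel_perfect E S"
proof (rule kernel_perfectI[OF assms(1,2)])
  have wf: "wf ((E \<inter> S \<times> S)\<inverse>)"
    using assms by (intro finite_acyclic_wf_converse) auto
  fix T assume T: "T \<subseteq> S" "T \<subseteq> in_nbhd E T"
  have "T = {}"
    using wfE_pf[OF wf, of T] T unfolding in_nbhd_def by blast
  then show "\<exists>K. kernel E T K" by (auto simp: kernel_def indep_def)
qed

section \<open>Digraphs\<close>

context digraph
begin

lemma irreflexive_arcs_ends: "(v, v) \<notin> arcs_ends G"
  using adj_not_same by blast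

lemma path_dist_le_0: "v \<in> verts G \<Longrightarrow> path_dist G v v \<le> 0"
proof -
  assume "v \<in> verts G"
  then have "apath v [] v" by (simp add: apath_Nil_iff)
  then have "path_dist G v v \<le> enat (length ([] :: 'b list))"
    unfolding path_dist_def by (intro INF_lower) simp
  then show ?thesis by (simp add: zero_enat_def)
qed

lemma path_dist_le_1:
  assumes "u \<rightarrow>\<^bsub>G\<^esub> v"
  shows "path_dist G u v \<le> 1"
proof -
  obtain e where "e \<in> arcs G" "tail G e = u" "head G e = v" using assms by auto
  then have "apath u [e] v" using no_loops by (auto simp: apath_simps)
  then have "path_dist G u v \<le> enat (length [e])"
    unfolding path_dist_def by (intro INF_lower) simp
  then show ?thesis by (simp add: one_enat_def)
qed

lemma path_dist_le_2:
  assumes "u \<rightarrow>\<^bsub>G\<^esub> w" "w \<rightarrow>\<^bsub>G\<^esub> v"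
  shows "path_dist G u v \<le> 2"
proof (cases "u = v")
  case True
  then have "path_dist G u v \<le> 0" using path_dist_le_0 assms adj_in_verts by blast
  then show ?thesis by simp
next
  case False
  obtain e where e: "e \<in> arcs G" "tail G e = u" "head G e = w" using assms(1) by auto
  obtain f where f: "f \<in> arcs G" "tail G f = w" "head G f = v" using assms(2) by auto
  have "apath u [e, f] v" using e f no_loops False by (auto simp: apath_simps)
  then have "path_dist G u v \<le> enat (length [e, f])"
    unfolding path_dist_def by (intro INF_lower) simp
  then show ?thesis by (simp add: numeral_eq_enat numeral_2_eq_2)
qed

lemma set_dist_le: "v \<in> S \<Longrightarrow> path_dist G u v \<le> d \<Longrightarrow> set_dist G u S \<le> d"
  unfolding set_dist_def by (rule INF_lower2)

text \<open>Distances are defined by paths and \<open>quasi_ker\<close> by walks; in a loop-free digraph a walk of length 2 is a path unless its ends coincide.\<close>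

lemma quasi_kernelI:
  assumes "quasi_ker (arcs_ends G) (verts G) Q"
  shows "quasi_kernel G Q"
  unfolding quasi_kernel_def
proof (intro conjI ballI)
  show "independent_set G Q"
    using assms unfolding quasi_ker_def indep_def independent_set_def by blast
  fix u assume u: "u \<in> verts G"
  then consider "u \<in> Q" | v where "v \<in> Q" "u \<rightarrow>\<^bsub>G\<^esub> v"
    | w v where "v \<in> Q" "u \<rightarrow>\<^bsub>G\<^esub> w" "w \<rightarrow>\<^bsub>G\<^esub> v"
    using assms unfolding quasi_ker_def in_nbhd_def by blast
  then show "set_dist G u Q \<le> 2"
  proof cases
    case 1
    then show ?thesis using path_dist_le_0[OF u] by (intro set_dist_le) auto
  next
    case 2
    have "(1 :: enat) \<le> 2" by (simp add: one_enat_def numeral_eq_enat)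
    then show ?thesis using 2 path_dist_le_1 by (meson order_trans set_dist_le)
  next
    case 3
    then show ?thesis using path_dist_le_2 set_dist_le by blast
  qed
qed

lemma in_nbhd_subset_closed_in_nbhd:
  "(Q \<union> in_nbhd (arcs_ends G) Q) \<inter> verts G \<subseteq> closed_in_nbhd G Q"
proof
  fix u assume u: "u \<in> (Q \<union> in_nbhd (arcs_ends G) Q) \<inter> verts G"
  have "set_dist G u Q \<le> 1"
  proof (cases "u \<in> Q")
    case True
    then show ?thesis using path_dist_le_0[of u] u by (intro set_dist_le) auto
  next
    case False
    then show ?thesis using u path_dist_le_1 set_dist_le unfolding in_nbhd_def by blast
  qed
  then show "u \<in> closed_in_nbhd G Q" using u by (simp add: closed_in_nbhd_def)
qed

lemma independent_imp_acyclic_set: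
  assumes "independent_set G S"
  shows "acyclic_set G S"
  unfolding acyclic_set_def
proof (intro conjI notI)
  show "S \<subseteq> verts G" using assms by (simp add: independent_set_def)
  assume "\<exists>p. pre_digraph.cycle (G \<restriction> S) p"
  then obtain u p where "pre_digraph.awalk (G \<restriction> S) u p u" "p \<noteq> []"
    by (auto simp: pre_digraph.cycle_def)
  then obtain e where "e \<in> arcs (G \<restriction> S)"
    by (cases p) (auto simp: pre_digraph.awalk_def)
  then have e: "e \<in> arcs G" "tail G e \<in> S" "head G e \<in> S" by auto
  then have "tail G e \<rightarrow>\<^bsub>G\<^esub> head G e" by (intro in_arcs_imp_in_arcs_ends)
  then show False using e assms unfolding independent_set_def by blast
qed

lemma acyclic_set_imp_kernel_perfect:
  assumes "acyclic_set G S"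
  shows "kernel_perfect (arcs_ends G) S"
proof (rule kernel_perfect_acyclic)
  show "finite S"
    using assms finite_subset[OF _ finite_verts] by (simp add: acyclic_set_def)
  interpret H: wf_digraph "G \<restriction> S" by (rule wellformed_induce_subgraph)
  show "acyclic (arcs_ends G \<inter> S \<times> S)"
  proof (rule acyclicI, intro allI notI)
    fix v assume "(v, v) \<in> (arcs_ends G \<inter> S \<times> S)\<^sup>+"
    moreover have "arcs_ends G \<inter> S \<times> S \<subseteq> arcs_ends (G \<restriction> S)"
      by (auto simp: arcs_ends_def arc_to_ends_def)
    ultimately have "v \<rightarrow>\<^sup>+\<^bsub>G \<restriction> S\<^esub> v" by (rule trancl_mono)
    then obtain p where "H.awalk v p v" "p \<noteq> []" by (auto simp: H.reachable1_awalk)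
    then have "H.closed_w p" by (auto simp: H.closed_w_def)
    then show False using H.closed_w_imp_cycle assms by (auto simp: acyclic_set_def)
  qed
qed (rule irreflexive_arcs_ends)

lemma partition_into_singletons_independent:
  "\<exists>P. partition_on (verts G) P \<and> (\<forall>S\<in>P. independent_set G S)"
proof (intro exI conjI ballI)
  show "partition_on (verts G) ((\<lambda>v. {v}) ` verts G)"
    by (rule partition_onI) auto
  show "independent_set G S" if "S \<in> (\<lambda>v. {v}) ` verts G" for S
    using that irreflexive_arcs_ends by (auto simp: independent_set_def)
qed

lemma chromatic_partition:
  obtains P where "partition_on (verts G) P" "card P = chromatic_number G"
    "\<And>S. S \<in> P \<Longrightarrow> independent_set G S"
proof -
  have "\<exists>m P. partition_on (verts G) P \<and> card P = m \<and> (\<forall>S\<in>P. independent_set G S)"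
    using partition_into_singletons_independent by blast
  from LeastI_ex[OF this] show thesis
    unfolding chromatic_number_def[symmetric] using that by blast
qed

lemma dichromatic_partition:
  obtains P where "partition_on (verts G) P" "card P = dichromatic_number G"
    "\<And>S. S \<in> P \<Longrightarrow> acyclic_set G S"
proof -
  have "\<exists>m P. partition_on (verts G) P \<and> card P = m \<and> (\<forall>S\<in>P. acyclic_set G S)"
    using partition_into_singletons_independent independent_imp_acyclic_set by blast
  from LeastI_ex[OF this] show thesis
    unfolding dichromatic_number_def[symmetric] using that by blast
qed

end

text \<open>The sequence is padded with empty sets if the partition has fewer than \<open>m\<close> classes.\<close>

lemma partition_as_sequence:
  assumes "finite V" "partition_on V P" "card P \<le> m"
  obtains S where "\<And>i. S i \<in> insert {} P" "V = (\<Union>i<m. S i)"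
proof -
  have "finite P" using assms finite_elements by blast
  then obtain h where h: "bij_betw h {0..<card P} P" using ex_bij_betw_nat_finite by blast
  define S where "S i = (if i < card P then h i else {})" for i
  have hP: "h ` {0..<card P} = P" using h by (simp add: bij_betw_def)
  have S_in: "S i \<in> insert {} P" for i using hP by (auto simp: S_def)
  show thesis
  proof (rule that)
    show "S i \<in> insert {} P" for i by (rule S_in)
    have "\<Union>P = (\<Union>i<m. S i)"
    proof
      have "S i \<subseteq> \<Union>P" for i using S_in[of i] by auto
      then show "(\<Union>i<m. S i) \<subseteq> \<Union>P" by (intro UN_least)
      show "\<Union>P \<subseteq> (\<Union>i<m. S i)"
      proof
        fix v assume "v \<in> \<Union>P"
        then obtain T where T: "T \<in> P" "v \<in> T" by blast
        then have "T \<in> h ` {0..<card P}" by (simp only: hP)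
        then obtain i where i: "i < card P" "T = h i" by auto
        have "i \<in> {..<m}" using i(1) assms(3) by simp
        moreover have "v \<in> S i" using i T(2) by (simp add: S_def)
        ultimately show "v \<in> (\<Union>i<m. S i)" by (rule UN_I)
      qed
    qed
    then show "V = (\<Union>i<m. S i)" using assms(2) by (simp add: partition_on_def)
  qed
qed

text \<open>In the chromatic case the at most \<open>2 * k\<close> independent classes are joined in pairs.\<close>

lemma (in digraph) kernel_perfect_cover:
  assumes "dichromatic_number G \<le> k \<or> chromatic_number G \<le> 2 * k"
  obtains S where "\<And>i. S i \<subseteq> verts G \<and> kernel_perfect (arcs_ends G) (S i)"
    and "verts G \<subseteq> (\<Union>i<k. S i)"
  using assms
proof
  assume k: "dichromatic_number G \<le> k"
  obtain P where P: "partition_on (verts G) P" "card P = dichromatic_number G"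
    "\<And>S. S \<in> P \<Longrightarrow> acyclic_set G S" using dichromatic_partition by blast
  obtain S where S: "\<And>i. S i \<in> insert {} P" "verts G = (\<Union>i<k. S i)"
    using partition_as_sequence[OF finite_verts P(1)] k P(2) by metis
  have "acyclic_set G {}"
    by (rule independent_imp_acyclic_set) (simp add: independent_set_def)
  then have "acyclic_set G (S i)" for i using S(1)[of i] P(3) by auto
  then show thesis
    using that[of S] S(2) acyclic_set_imp_kernel_perfect by (simp add: acyclic_set_def)
next
  assume k: "chromatic_number G \<le> 2 * k"
  obtain P where P: "partition_on (verts G) P" "card P = chromatic_number G"
    "\<And>S. S \<in> P \<Longrightarrow> independent_set G S" using chromatic_partition by blast
  obtain S where S: "\<And>i. S i \<in> insert {} P" "verts G = (\<Union>i<2 * k. S i)"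
    using partition_as_sequence[OF finite_verts P(1)] k P(2) by metis
  have "independent_set G {}" by (simp add: independent_set_def)
  then have ind: "independent_set G (S i)" for i using S(1)[of i] P(3) by auto
  show thesis
  proof (rule that)
    show "S (2 * i) \<union> S (2 * i + 1) \<subseteq> verts G \<and>
      kernel_perfect (arcs_ends G) (S (2 * i) \<union> S (2 * i + 1))" for i
    proof
      show sub: "S (2 * i) \<union> S (2 * i + 1) \<subseteq> verts G"
        using ind by (simp add: independent_set_def)
      show "kernel_perfect (arcs_ends G) (S (2 * i) \<union> S (2 * i + 1))"
        using sub ind irreflexive_arcs_ends finite_subset[OF _ finite_verts]
        by (intro kernel_perfect_Un_indep) (auto simp: independent_set_def indep_def)
    qed
    show "verts G \<subseteq> (\<Union>i<k. S (2 * i) \<union> S (2 * i + 1))"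
    proof
      fix v assume "v \<in> verts G"
      then obtain j where j: "j < 2 * k" "v \<in> S j" using S(2) by blast
      have "j = 2 * (j div 2) \<or> j = 2 * (j div 2) + 1" by presburger
      then have "v \<in> S (2 * (j div 2)) \<union> S (2 * (j div 2) + 1)" using j(2) by auto
      moreover have "j div 2 < k" using j(1) by simp
      ultimately show "v \<in> (\<Union>i<k. S (2 * i) \<union> S (2 * i + 1))" by blast
    qed
  qed
qed

theorem corollary1p10:
  fixes D :: "('a,'b) pre_digraph" and k :: nat
  assumes "digraph D"
    and "k \<ge> 2"
    and "dichromatic_number D \<le> k \<or> chromatic_number D \<le> 2 * k"
  shows "(sink_free D \<longrightarrow>
            (\<exists>Q. quasi_kernel D Q \<and> real (card Q) \<le> (1 - 1 / real k) * real (card (verts D)))) \<and>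
         (\<exists>Q. quasi_kernel D Q \<and>
            real (card Q) \<le> real (card (verts D))
              - real (card {v. is_source D v \<and> \<not> is_sink D v}) / real k) \<and>
         (\<exists>Q. quasi_kernel D Q \<and>
            real (card (closed_in_nbhd D Q)) \<ge> real (card (verts D)) / real k)"
proof -
  interpret digraph D by (rule assms(1))
  let ?E = "arcs_ends D" and ?V = "verts D"
  obtain S where S: "\<And>i. S i \<subseteq> ?V \<and> kernel_perfect ?E (S i)" "?V \<subseteq> (\<Union>i<k. S i)"
    using kernel_perfect_cover[OF assms(3)] by blast
  have EV: "?E \<subseteq> ?V \<times> ?V" using adj_in_verts by auto
  have k: "k > 0" using assms(2) by simp
  note irr = irreflexive_arcs_ends
  have size: "real (card Q) \<le> real (card ?V) - real s / real k"
    if "quasi_ker ?E ?V Q" "s \<le> k * card (?V - Q)" for Q s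
  proof -
    have "Q \<subseteq> ?V" using that(1) by (simp add: quasi_ker_def)
    then have "card Q + card (?V - Q) = card ?V"
      by (metis card_Diff_subset card_mono finite_subset finite_verts le_add_diff_inverse)
    then have "real (card ?V) = real (card Q) + real (card (?V - Q))" by linarith
    moreover have "real s \<le> real k * real (card (?V - Q))"
      using that(2) by (metis of_nat_le_iff of_nat_mult)
    then have "real s / real k \<le> real (card (?V - Q))"
      using k by (simp add: divide_le_eq mult.commute)
    ultimately show ?thesis by linarith
  qed
  have I: "\<exists>Q. quasi_kernel D Q \<and> real (card Q) \<le> (1 - 1 / real k) * real (card ?V)"
    if "sink_free D"
  proof -
    have "?V \<subseteq> Domain ?E" using that by (auto simp: sink_free_def is_sink_def)
    then obtain Q where Q: "quasi_ker ?E ?V Q" "card ?V \<le> k * card (?V - Q)"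
      using small_quasi_ker[OF finite_verts EV irr assms(2), of S] S by blast
    have "real (card Q) \<le> (1 - 1 / real k) * real (card ?V)"
      using size[OF Q] by (simp add: algebra_simps)
    then show ?thesis using quasi_kernelI[OF Q(1)] by blast
  qed
  have "{v. is_source D v \<and> \<not> is_sink D v} = Domain ?E - Range ?E"
    using EV by (auto simp: is_source_def is_sink_def)
  moreover obtain Q where Q: "quasi_ker ?E ?V Q"
    "card (Domain ?E - Range ?E) \<le> k * card (?V - Q)"
    using quasi_ker_avoiding_sources[OF finite_verts EV irr k, of S] S by blast
  ultimately have II: "\<exists>Q. quasi_kernel D Q \<and> real (card Q) \<le> real (card ?V)
      - real (card {v. is_source D v \<and> \<not> is_sink D v}) / real k"
    using size[OF Q] quasi_kernelI[OF Q(1)] by auto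
  obtain Q' where Q': "quasi_ker ?E ?V Q'"
    "card ?V \<le> k * card ((Q' \<union> in_nbhd ?E Q') \<inter> ?V)"
    using quasi_ker_large_in_nbhd[OF finite_verts irr k, of S] S by blast
  have "finite (closed_in_nbhd D Q')" by (simp add: closed_in_nbhd_def)
  then have "card ((Q' \<union> in_nbhd ?E Q') \<inter> ?V) \<le> card (closed_in_nbhd D Q')"
    using in_nbhd_subset_closed_in_nbhd by (rule card_mono)
  then have "card ?V \<le> k * card (closed_in_nbhd D Q')"
    using Q'(2) by (meson le_trans mult_le_mono2)
  then have "real (card ?V) \<le> real k * real (card (closed_in_nbhd D Q'))"
    by (metis of_nat_le_iff of_nat_mult)
  then have "real (card ?V) / real k \<le> real (card (closed_in_nbhd D Q'))"
    using k by (simp add: divide_le_eq mult.commute)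
  then show ?thesis using I II quasi_kernelI[OF Q'(1)] by blast
qed

end
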